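(* Let $C$ be a commutative ring with unity, let $n\geq 2$, and let $\mathcal{T}_n(C)$ be the $C$-algebra of $n\times n$ upper triangular matrices over $C$. Then every derivation $D:\mathcal{T}_n(C)\to\mathcal{T}_n(C)$ is an inner derivation.
   Context: Let $T$ be an algebra over a commutative ring $C$ with unity. A $C$-linear map $D:T\to T$ is a derivation if $D(ab)=D(a)b+aD(b)$ for all $a,b\in T$. A derivation $D:T\to T$ is an inner derivation if there exists $a_0\in T$ such that $D(a)=a_0a-aa_0$ for all $a\in T$. The ring $C$ is not assumed to be $2$-torsion free. *)

theory Defs
  imports "Jordan_Normal_Form.Matrix"
begin

definition upper_tri_mats :: "nat \<Rightarrow> 'a::zero mat set" where
  "upper_tri_mats n = {A \<in> carrier_mat n n. upper_triangular A}"

text \<open>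
  Algebras of matrices are given by their carrier set \<open>T\<close>, with the operations inherited from
  type \<open>'a mat\<close>. The map \<open>D\<close> is a total HOL function; only its values on \<open>T\<close> matter.
  The sort \<open>{comm_ring, comm_monoid_mult}\<close> is that of commutative rings with unity; unlike
  \<open>comm_ring_1\<close>, it does not demand \<open>0 \<noteq> 1\<close>, so the zero ring is included.
\<close>

definition mat_derivation ::
  "'a::{comm_ring, comm_monoid_mult} mat set \<Rightarrow> ('a mat \<Rightarrow> 'a mat) \<Rightarrow> bool" where
  "mat_derivation T D \<longleftrightarrow>
     (\<forall>a\<in>T. D a \<in> T) \<and>
     (\<forall>a\<in>T. \<forall>b\<in>T. D (a + b) = D a + D b) \<and>
     (\<forall>c. \<forall>a\<in>T. D (c \<cdot>\<^sub>m a) = c \<cdot>\<^sub>m D a) \<and>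
     (\<forall>a\<in>T. \<forall>b\<in>T. D (a * b) = D a * b + a * D b)"

definition inner_mat_derivation ::
  "'a::{comm_ring, comm_monoid_mult} mat set \<Rightarrow> ('a mat \<Rightarrow> 'a mat) \<Rightarrow> bool" where
  "inner_mat_derivation T D \<longleftrightarrow>
     mat_derivation T D \<and> (\<exists>a0\<in>T. \<forall>a\<in>T. D a = a0 * a - a * a0)"

end

theory Submission imports Defs begin

text \<open>
  The right ideal of matrices supported on the first row is a copy of the row space \<open>C\<^sup>n\<close>, on
  which \<open>\<T>\<^sub>n(C)\<close> acts faithfully from the right. Let \<open>M\<^sub>j\<^sub>k\<close> be the entry at position
  \<open>(1, k)\<close> of \<open>D(e\<^sub>1\<^sub>j)\<close>. Comparing first rows in
  \<open>D(e\<^sub>1\<^sub>j b) = D(e\<^sub>1\<^sub>j) b + e\<^sub>1\<^sub>j D(b)\<close> gives \<open>D(b) = b M - M b\<close>, and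
  \<open>e\<^sub>1\<^sub>j = e\<^sub>1\<^sub>j e\<^sub>j\<^sub>j\<close> shows that \<open>M\<close> is upper triangular. So \<open>D\<close> is the inner derivation
  given by \<open>-M\<close>.
\<close>

text \<open>Embeds the row space into the matrices. Indices start at 0 here, so the position (1, k)
  of the overview becomes \<open>(0, k)\<close>, and \<open>first_row_mat n (elem_row j)\<close> is
  the matrix unit written there with first index 1.\<close>

definition first_row_mat :: "nat \<Rightarrow> (nat \<Rightarrow> 'a::zero) \<Rightarrow> 'a mat" where
  "first_row_mat n r = mat n n (\<lambda>(i, j). if i = 0 then r j else 0)"

definition elem_row :: "nat \<Rightarrow> nat \<Rightarrow> 'a::{zero, one}" where
  "elem_row j k = (if k = j then 1 else 0)"

lemma upper_tri_mats_carrier: "A \<in> upper_tri_mats n \<Longrightarrow> A \<in> carrier_mat n n"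
  by (simp add: upper_tri_mats_def)

lemma upper_tri_mats_zero: "A \<in> upper_tri_mats n \<Longrightarrow> j < i \<Longrightarrow> i < n \<Longrightarrow> A $$ (i, j) = 0"
  by (auto simp: upper_tri_mats_def)

lemma upper_tri_matsI:
  assumes "\<And>i j. j < i \<Longrightarrow> i < n \<Longrightarrow> f (i, j) = 0"
  shows "mat n n f \<in> upper_tri_mats n"
  using assms by (auto simp: upper_tri_mats_def upper_triangular_def)

lemma first_row_mat_upper_tri: "first_row_mat n r \<in> upper_tri_mats n"
  unfolding first_row_mat_def by (rule upper_tri_matsI) simp

lemma index_mult_mat_sum:
  fixes A B :: "'a::semiring_0 mat"
  assumes "A \<in> carrier_mat n n" "B \<in> carrier_mat n n" "i < n" "k < n"
  shows "(A * B) $$ (i, k) = (\<Sum>l<n. A $$ (i, l) * B $$ (l, k))"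
  using assms by (auto simp: scalar_prod_def lessThan_atLeast0 intro!: sum.cong)

text \<open>All other rows of the left factor vanish, so right multiplication acts on
  \<open>r\<close> as on a row vector.\<close>

lemma first_row_mat_mult:
  fixes B :: "'a::semiring_0 mat"
  assumes "B \<in> carrier_mat n n"
  shows "first_row_mat n r * B = first_row_mat n (\<lambda>k. \<Sum>l<n. r l * B $$ (l, k))"
    (is "_ = ?R")
proof (rule eq_matI)
  fix i k assume "i < dim_row ?R" "k < dim_col ?R"
  then have "i < n" "k < n" by (auto simp: first_row_mat_def)
  then show "(first_row_mat n r * B) $$ (i, k) = ?R $$ (i, k)"
    using assms by (subst index_mult_mat_sum[where n = n]) (auto simp: first_row_mat_def)
qed (use assms in \<open>auto simp: first_row_mat_def\<close>)

lemma elem_row_mult_sum: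
  fixes f :: "nat \<Rightarrow> 'a::{comm_ring, comm_monoid_mult}"
  assumes "j < n"
  shows "(\<Sum>l<n. elem_row j l * f l) = f j"
proof -
  have "(\<Sum>l<n. elem_row j l * f l) = (\<Sum>l<n. if l = j then f l else 0)"
    by (rule sum.cong) (auto simp: elem_row_def)
  then show ?thesis using assms by simp
qed

text \<open>Additivity and homogeneity extend to the expansion of a row in the standard basis, by
  induction on the number \<open>m\<close> of leading entries of \<open>r\<close> that are
  kept.\<close>

lemma first_row_derivation_linear:
  fixes D :: "'a::{comm_ring, comm_monoid_mult} mat \<Rightarrow> 'a mat"
  assumes D: "mat_derivation (upper_tri_mats n) D"
    and n: "0 < n" and k: "k < n"
  shows "D (first_row_mat n r) $$ (0, k)
    = (\<Sum>l<n. r l * D (first_row_mat n (elem_row l)) $$ (0, k))"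
proof -
  have carr: "D (first_row_mat n s) \<in> carrier_mat n n" for s
    using D first_row_mat_upper_tri upper_tri_mats_carrier unfolding mat_derivation_def by blast
  have part: "D (first_row_mat n (\<lambda>l. if l < m then r l else 0)) $$ (0, k)
    = (\<Sum>l<m. r l * D (first_row_mat n (elem_row l)) $$ (0, k))" for m
  proof (induction m)
    case 0
    let ?z = "first_row_mat n (\<lambda>l. 0) :: 'a mat"
    \<comment> \<open>That \<open>D\<close> kills the zero matrix comes from homogeneity with the
      scalar 0.\<close>
    have "?z = 0 \<cdot>\<^sub>m ?z"
      by (auto simp: first_row_mat_def)
    then have "D ?z = 0 \<cdot>\<^sub>m D ?z"
      using D first_row_mat_upper_tri unfolding mat_derivation_def by metis
    then have "D ?z $$ (0, k) = (0 \<cdot>\<^sub>m D ?z) $$ (0, k)" by simp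
    also have "\<dots> = 0" using carr[of "\<lambda>l. 0"] n k by simp
    finally show ?case by simp
  next
    case (Suc m)
    let ?s = "\<lambda>m. first_row_mat n (\<lambda>l. if l < m then r l else 0)"
    let ?e = "first_row_mat n (elem_row m) :: 'a mat"
    have re: "r m \<cdot>\<^sub>m ?e = first_row_mat n (\<lambda>l. r m * elem_row m l)"
      by (rule eq_matI) (auto simp: first_row_mat_def)
    have "?s (Suc m) = ?s m + r m \<cdot>\<^sub>m ?e"
      unfolding re by (rule eq_matI) (auto simp: first_row_mat_def elem_row_def less_Suc_eq)
    then have "D (?s (Suc m)) = D (?s m) + D (r m \<cdot>\<^sub>m ?e)"
      using D first_row_mat_upper_tri re unfolding mat_derivation_def by metis
    also have "D (r m \<cdot>\<^sub>m ?e) = r m \<cdot>\<^sub>m D ?e"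
      using D first_row_mat_upper_tri unfolding mat_derivation_def by blast
    finally show ?case
      using Suc.IH n k carr[of "elem_row m"] carr[of "\<lambda>l. if l < m then r l else 0"] by simp
  qed
  \<comment> \<open>The matrix does not see the values of \<open>r\<close> from index
    \<open>n\<close> on.\<close>
  have "first_row_mat n r = first_row_mat n (\<lambda>l. if l < n then r l else 0)"
    by (rule eq_matI) (auto simp: first_row_mat_def)
  then show ?thesis using part[of n] by simp
qed

theorem theorem2p2:
  fixes D :: "'a::{comm_ring, comm_monoid_mult} mat \<Rightarrow> 'a mat" and n :: nat
  assumes "n \<ge> 2"
    and "mat_derivation (upper_tri_mats n) D"
  shows "inner_mat_derivation (upper_tri_mats n) D"
proof -
  note D = assms(2)
  have n: "0 < n" using assms(1) by simp
  let ?T = "upper_tri_mats n :: 'a mat set"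
  let ?e = "\<lambda>j. first_row_mat n (elem_row j) :: 'a mat"
  define M where "M j k = D (?e j) $$ (0, k)" for j k
  define a where "a = mat n n (\<lambda>(j, k). - M j k)"
  have DT: "D b \<in> ?T" if "b \<in> ?T" for b
    using D that unfolding mat_derivation_def by blast
  \<comment> \<open>\<open>?e j\<close> moves row \<open>j\<close> to the top, so the first rows of
    these products determine all of \<open>B\<close>: this is the faithfulness of the
    action.\<close>
  have e_mult: "(?e j * B) $$ (0, k) = B $$ (j, k)"
    if "B \<in> carrier_mat n n" "j < n" "k < n" for B j k
    unfolding first_row_mat_mult[OF that(1)]
    using that n by (simp add: first_row_mat_def elem_row_mult_sum)
  have product_rule: "D (?e j * b) $$ (0, k) = (\<Sum>l<n. M j l * b $$ (l, k)) + D b $$ (j, k)"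
    if b: "b \<in> ?T" and j: "j < n" and k: "k < n" for b j k
  proof -
    have c: "b \<in> carrier_mat n n" "D b \<in> carrier_mat n n" "D (?e j) \<in> carrier_mat n n"
      "?e j \<in> carrier_mat n n"
      using b DT first_row_mat_upper_tri upper_tri_mats_carrier by blast+
    have "D (?e j * b) = D (?e j) * b + ?e j * D b"
      using D b first_row_mat_upper_tri unfolding mat_derivation_def by blast
    then have "D (?e j * b) $$ (0, k) = (D (?e j) * b) $$ (0, k) + (?e j * D b) $$ (0, k)"
      using c n k by simp
    also have "(D (?e j) * b) $$ (0, k) = (\<Sum>l<n. M j l * b $$ (l, k))"
      using index_mult_mat_sum[OF c(3,1) n k] by (simp add: M_def)
    also have "(?e j * D b) $$ (0, k) = D b $$ (j, k)"
      using e_mult c j k by blast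
    finally show ?thesis .
  qed
  have M_upper: "M j k = 0" if "k < j" "j < n" for j k
  proof -
    \<comment> \<open>The diagonal idempotent at \<open>j\<close> fixes \<open>?e j\<close> from the
      right. In its product rule the sum vanishes because column \<open>k\<close> of
      \<open>?d\<close> is zero, and the other term because \<open>D ?d\<close> is upper
      triangular.\<close>
    let ?d = "mat n n (\<lambda>(i, l). if i = j \<and> l = j then 1 else 0) :: 'a mat"
    have k: "k < n" using that by simp
    have d: "?d \<in> ?T" by (rule upper_tri_matsI) auto
    have "?e j * ?d = first_row_mat n (\<lambda>l. \<Sum>i<n. elem_row j i * ?d $$ (i, l))"
      by (rule first_row_mat_mult) simp
    also have "\<dots> = ?e j"
    proof -
      have "(\<Sum>i<n. elem_row j i * ?d $$ (i, l)) = elem_row j l" if "l < n" for l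
        unfolding elem_row_mult_sum[OF \<open>j < n\<close>]
        using \<open>j < n\<close> that by (simp add: elem_row_def)
      then show ?thesis
        by (intro eq_matI) (auto simp: first_row_mat_def)
    qed
    finally have "M j k = (\<Sum>l<n. M j l * ?d $$ (l, k)) + D ?d $$ (j, k)"
      using product_rule[OF d that(2) k] by (simp add: M_def)
    also have "(\<Sum>l<n. M j l * ?d $$ (l, k)) = 0"
      by (rule sum.neutral) (use that k in auto)
    also have "D ?d $$ (j, k) = 0"
      using upper_tri_mats_zero[OF DT[OF d] that] .
    finally show ?thesis by simp
  qed
  have aT: "a \<in> ?T" unfolding a_def by (rule upper_tri_matsI) (simp add: M_upper)
  have "D b = a * b - b * a" if b: "b \<in> ?T" for b
  proof (rule eq_matI)
    have c: "a \<in> carrier_mat n n" "b \<in> carrier_mat n n" "D b \<in> carrier_mat n n"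
      using aT b DT upper_tri_mats_carrier by blast+
    then show "dim_row (D b) = dim_row (a * b - b * a)"
      "dim_col (D b) = dim_col (a * b - b * a)" by auto
    fix j k assume "j < dim_row (a * b - b * a)" "k < dim_col (a * b - b * a)"
    then have jk: "j < n" "k < n" using c by auto
    \<comment> \<open>The value of \<open>D\<close> at this product is computed twice, by the
      product rule and by linearity; equating the two gives the entry of \<open>D b\<close>.\<close>
    have "?e j * b = first_row_mat n (\<lambda>l. b $$ (j, l))"
      by (simp only: first_row_mat_mult[OF c(2)] elem_row_mult_sum[OF jk(1)])
    then have "(\<Sum>l<n. M j l * b $$ (l, k)) + D b $$ (j, k) = (\<Sum>l<n. b $$ (j, l) * M l k)"
      using product_rule[OF b jk]
        first_row_derivation_linear[OF D n jk(2), of "\<lambda>l. b $$ (j, l)"]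
      unfolding M_def by (simp only:)
    \<comment> \<open>The signs are arranged so that each negated sum is an entry of a product with
      \<open>a\<close>, whose entries are those of \<open>M\<close> negated.\<close>
    then have "D b $$ (j, k)
      = - (\<Sum>l<n. M j l * b $$ (l, k)) - - (\<Sum>l<n. b $$ (j, l) * M l k)"
      by (metis add_diff_cancel_left' diff_minus_eq_add uminus_add_conv_diff)
    also have "- (\<Sum>l<n. M j l * b $$ (l, k)) = (a * b) $$ (j, k)"
      using index_mult_mat_sum[OF c(1,2) jk] jk by (simp add: a_def sum_negf)
    also have "- (\<Sum>l<n. b $$ (j, l) * M l k) = (b * a) $$ (j, k)"
      using index_mult_mat_sum[OF c(2,1) jk] jk by (simp add: a_def sum_negf)
    also have "(a * b) $$ (j, k) - (b * a) $$ (j, k) = (a * b - b * a) $$ (j, k)"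
      using c jk by simp
    finally show "D b $$ (j, k) = (a * b - b * a) $$ (j, k)" .
  qed
  with aT D show ?thesis unfolding inner_mat_derivation_def by blast
qed

end
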